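(* Let $n\ge 3$ be an integer and let $T:\mathbb{S}^1\to\mathbb{S}^1$ be the finite Gauss transformation associated with the regular $n$-gon $P_1\dots P_n$ circumscribed around the unit circle $\mathbb{S}^1$ (defined in the context). Let $\mu$ be the measure on $\mathbb{S}^1$, absolutely continuous with respect to Lebesgue (arc-length) measure, whose density on each open arc $A_{j-1}A_j$, $j=1,\dots,n$, is $$\rho(\varphi)=\frac{\sin\frac{\pi}{n}}{\cos\varphi-\cos\frac{\pi}{n}},\qquad \varphi\in\left(-\tfrac{\pi}{n},\tfrac{\pi}{n}\right),$$ where $\varphi$ is the signed angle of the point of the arc measured from the direction of the vertex $P_j$. Then $\mu$ is invariant under $T$, i.e. $\mu(T^{-1}(A))=\mu(A)$ for every Borel set $A\subset\mathbb{S}^1$.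
   Context: Let $\mathbb{S}^1$ be the unit circle in the plane centered at the origin $O$, and let $P_1,\dots,P_n$ be the consecutive vertices of a regular $n$-gon circumscribed around $\mathbb{S}^1$ (each side is tangent to $\mathbb{S}^1$); indices are taken modulo $n$. Let $A_j$ be the point of tangency of $\mathbb{S}^1$ with the side $P_jP_{j+1}$. The points $A_1,\dots,A_n$ divide $\mathbb{S}^1$ into $n$ arcs; the arc $A_{j-1}A_j$ is the one facing the vertex $P_j$, i.e. it consists of the points of $\mathbb{S}^1$ whose angle with the ray $OP_j$ is at most $\pi/n$. The finite Gauss transformation $T$ is defined as follows: for $z$ in the arc $A_{j-1}A_j$, $T(z)$ is the second point of intersection of the line through $P_j$ and $z$ with $\mathbb{S}^1$ (with $T(z)=z$ when the line is tangent, i.e. when $z$ is one of the points $A_{j-1},A_j$). Invariant measures are not required to be finite: $\mu$ is a $\sigma$-finite measure, possibly of infinite total mass. *)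

theory Defs
  imports "HOL-Analysis.Analysis"
begin

text \<open>
  The plane is \<^typ>\<open>complex\<close> and the unit circle is \<open>sphere 0 1\<close>. Polygon vertices are indexed
  by all integers; the sequence of vertices of an \<open>n\<close>-gon is periodic with period \<open>n\<close>.
\<close>

text \<open>Centre \<open>c\<close>, first vertex \<open>c + w\<close>; the two choices of \<open>\<zeta>\<close> are the two orientations.\<close>

definition regular_polygon :: "nat \<Rightarrow> (int \<Rightarrow> complex) \<Rightarrow> bool" where
  "regular_polygon n P \<longleftrightarrow>
     n \<ge> 3 \<and>
     (\<exists>c w \<zeta>. w \<noteq> 0 \<and> \<zeta> \<in> {cis (2 * pi / real n), cis (- (2 * pi / real n))} \<and>
        (\<forall>j. P j = c + w * \<zeta> powi j))"

definition circumscribed :: "(int \<Rightarrow> complex) \<Rightarrow> bool" where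
  "circumscribed P \<longleftrightarrow>
     (\<forall>j. \<exists>A \<in> closed_segment (P j) (P (j + 1)).
        affine hull {P j, P (j + 1)} \<inter> sphere 0 1 = {A})"

definition signed_angle :: "complex \<Rightarrow> complex \<Rightarrow> real" where
  "signed_angle p z = Arg (z / p)"

definition facing_arc :: "nat \<Rightarrow> (int \<Rightarrow> complex) \<Rightarrow> int \<Rightarrow> complex set" where
  "facing_arc n P j = {z \<in> sphere 0 1. \<bar>signed_angle (P j) z\<bar> \<le> pi / real n}"

definition open_facing_arc :: "nat \<Rightarrow> (int \<Rightarrow> complex) \<Rightarrow> int \<Rightarrow> complex set" where
  "open_facing_arc n P j = {z \<in> sphere 0 1. \<bar>signed_angle (P j) z\<bar> < pi / real n}"

text \<open>
  The equation with \<open>{z, w}\<close> determines \<open>w\<close> as the second intersection point of a secant, and forces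
  \<open>w = z\<close> when the line is tangent. A common endpoint of two arcs is fixed for both values of \<open>j\<close>.
  Only the values on the unit circle are meaningful.
\<close>

definition finite_gauss_map :: "nat \<Rightarrow> (int \<Rightarrow> complex) \<Rightarrow> complex \<Rightarrow> complex" where
  "finite_gauss_map n P z =
     (THE w. \<exists>j. z \<in> facing_arc n P j \<and> affine hull {P j, z} \<inter> sphere 0 1 = {z, w})"

definition circle_borel :: "complex measure" where
  "circle_borel = restrict_space borel (sphere 0 1)"

definition arc_length_measure :: "complex measure" where
  "arc_length_measure = distr (restrict_space lborel {-pi<..pi}) circle_borel cis"

end

theory Submission
  imports Defs
begin

text \<open>
  Write \<open>a = pi / n\<close>, \<open>C = cos a\<close>, \<open>S = sin a\<close>. On each arc, \<open>T\<close> is a Moebius involution exchanging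
  the arc with its complement; in the coordinate \<open>x = tan (\<phi> / 2)\<close> it is \<open>x \<mapsto> (tan (a / 2))\<^sup>2 / x\<close>.
  A change of variables shows that it carries the density \<open>S / (cos \<phi> - C)\<close> on the arc to
  \<open>S / (C - cos \<phi>)\<close> on the complement. Hence \<open>\<mu>\<close> is invariant if and only if the function
  \<open>S / (cos \<phi> - C)\<close>, summed over the \<open>n\<close> angles \<open>\<phi>\<close> of a point seen from the vertices, vanishes.
  Since \<open>2 S / (cos \<phi> - C) = cot ((a - \<phi>) / 2) + cot ((a + \<phi>) / 2)\<close>, this sum telescopes to \<open>0\<close>.
\<close>

subsection \<open>Equally spaced angles\<close>

text \<open>Rounding \<open>x / (2 * pi)\<close> moves \<open>x\<close> into [-pi, pi], where cosine
  is even and decreases with the absolute value.\<close>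

lemma cos_ge_cos_iff:
  assumes "0 \<le> a" "a \<le> pi"
  shows "cos a \<le> cos x \<longleftrightarrow> (\<exists>m::int. \<bar>x - 2 * pi * m\<bar> \<le> a)"
    and "cos a < cos x \<longleftrightarrow> (\<exists>m::int. \<bar>x - 2 * pi * m\<bar> < a)"
proof -
  have periodic: "cos x = cos \<bar>x - 2 * pi * m\<bar>" for m :: int
    by (simp add: cos_diff)
  define m :: int where "m = round (x / (2 * pi))"
  have "\<bar>real_of_int m - x / (2 * pi)\<bar> \<le> 1 / 2"
    unfolding m_def by (rule of_int_round_abs_le)
  then have "\<bar>2 * pi\<bar> * \<bar>real_of_int m - x / (2 * pi)\<bar> \<le> 2 * pi * (1 / 2)"
    by (simp add: mult_left_mono)
  then have m: "\<bar>x - 2 * pi * m\<bar> \<le> pi"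
    unfolding abs_mult[symmetric] by (simp add: algebra_simps abs_minus_commute)
  show "cos a \<le> cos x \<longleftrightarrow> (\<exists>m::int. \<bar>x - 2 * pi * m\<bar> \<le> a)"
  proof
    assume "cos a \<le> cos x"
    then show "\<exists>m::int. \<bar>x - 2 * pi * m\<bar> \<le> a"
      using cos_mono_le_eq[of a "\<bar>x - 2 * pi * m\<bar>"] m assms periodic[of m] by auto
  next
    assume "\<exists>m::int. \<bar>x - 2 * pi * m\<bar> \<le> a"
    then obtain m :: int where "\<bar>x - 2 * pi * m\<bar> \<le> a" by blast
    then show "cos a \<le> cos x"
      using assms cos_monotone_0_pi_le[of "\<bar>x - 2 * pi * m\<bar>" a] periodic[of m] by simp
  qed
  show "cos a < cos x \<longleftrightarrow> (\<exists>m::int. \<bar>x - 2 * pi * m\<bar> < a)"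
  proof
    assume "cos a < cos x"
    then show "\<exists>m::int. \<bar>x - 2 * pi * m\<bar> < a"
      using cos_mono_less_eq[of a "\<bar>x - 2 * pi * m\<bar>"] m assms periodic[of m] by auto
  next
    assume "\<exists>m::int. \<bar>x - 2 * pi * m\<bar> < a"
    then obtain m :: int where "\<bar>x - 2 * pi * m\<bar> < a" by blast
    then show "cos a < cos x"
      using assms cos_monotone_0_pi[of "\<bar>x - 2 * pi * m\<bar>" a] periodic[of m] by simp
  qed
qed

lemma cos_less_cos_iff_abs:
  assumes "0 \<le> a" "a \<le> pi" "\<bar>x\<bar> \<le> pi"
  shows "cos a < cos x \<longleftrightarrow> \<bar>x\<bar> < a"
  using cos_mono_less_eq[of a "\<bar>x\<bar>"] assms by auto

text \<open>The angles are spaced by \<open>2 * pi / n\<close>, so one of them lies within half a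
  spacing, the half-width of an arc, of a multiple of \<open>2 * pi\<close>.\<close>

lemma arcs_cover:
  fixes n :: nat and t :: real
  assumes n: "n > 0"
  shows "\<exists>k<n. cos (pi / n) \<le> cos (t + 2 * pi / n * real k)"
proof -
  \<comment> \<open>Among all integers \<open>m\<close> brings \<open>t + 2 * pi / n * m\<close>
    closest to 0; reducing it modulo \<open>n\<close> changes the angle by whole turns only.\<close>
  define m :: int where "m = round (- t * n / (2 * pi))"
  define k where "k = nat (m mod int n)"
  have k: "k < n" "int k = m mod int n"
    using n by (auto simp: k_def nat_less_iff)
  have "m = int k + int n * (m div int n)"
    using k by simp
  then have mk: "real_of_int m = real k + real n * real_of_int (m div int n)"
    by (metis of_int_add of_int_mult of_int_of_nat_eq)
  have "\<bar>real_of_int m - (- t * n / (2 * pi))\<bar> \<le> 1 / 2"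
    unfolding m_def by (rule of_int_round_abs_le)
  then have "\<bar>2 * pi / n\<bar> * \<bar>real_of_int m - (- t * n / (2 * pi))\<bar> \<le> \<bar>2 * pi / n\<bar> * (1 / 2)"
    by (rule mult_left_mono) simp
  moreover have "2 * pi / n * (real_of_int m - (- t * n / (2 * pi)))
      = t + 2 * pi / n * real k - 2 * pi * of_int (- (m div int n))"
    using n unfolding mk by (simp add: field_simps)
  ultimately have "\<bar>t + 2 * pi / n * real k - 2 * pi * of_int (- (m div int n))\<bar> \<le> pi / n"
    unfolding abs_mult[symmetric] by (simp only: mult.assoc) simp
  then have "cos (pi / n) \<le> cos (t + 2 * pi / n * real k)"
    using n by (subst cos_ge_cos_iff(1)) (auto simp: field_simps intro!: exI[of _ "- (m div int n)"])
  then show ?thesis using k by blast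
qed

text \<open>Modulo full turns the two angles differ by \<open>2 * pi / n\<close> times an integer
  \<open>d\<close>. One strict bound already gives \<open>\<bar>d\<bar> < 1\<close>, so closed arcs
  can meet only at endpoints.\<close>

lemma arcs_overlap:
  fixes n k l :: nat and t :: real
  assumes kl: "k < n" "l < n"
    and "cos (pi / n) < cos (t + 2 * pi / n * real k)"
    and "cos (pi / n) \<le> cos (t + 2 * pi / n * real l)"
  shows "k = l"
proof -
  have n: "n > 0" using kl by simp
  have a: "0 \<le> pi / n" "pi / n \<le> pi" using n by (auto simp: field_simps)
  obtain m m' :: int where m: "\<bar>t + 2 * pi / n * real k - 2 * pi * m\<bar> < pi / n"
    "\<bar>t + 2 * pi / n * real l - 2 * pi * m'\<bar> \<le> pi / n"
    using assms(3,4) cos_ge_cos_iff[OF a] by meson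
  define d :: int where "d = (int k - int l) - int n * (m - m')"
  have "2 * pi / n * real_of_int d = (t + 2 * pi / n * real k - 2 * pi * m)
      - (t + 2 * pi / n * real l - 2 * pi * m')"
    using n unfolding d_def by (simp add: field_simps)
  then have "\<bar>2 * pi / n * real_of_int d\<bar> < 2 * pi / n * 1"
    using m by linarith
  then have "\<bar>real_of_int d\<bar> < 1"
    using n unfolding abs_mult by (simp add: field_simps)
  then have "d = 0" by linarith
  then have "int k - int l = int n * (m - m')" unfolding d_def by simp
  moreover have "\<bar>int k - int l\<bar> < int n" using kl by auto
  ultimately show "k = l"
    by (metis abs_of_nat diff_eq_diff_eq dvd_imp_le_int dvd_triv_left eq_iff_diff_eq_0 leD of_nat_eq_iff)
qed

lemma cos_diff_eq_zero_iff:
  "cos x - cos y = 0 \<longleftrightarrow> sin ((x + y) / 2) = 0 \<or> sin ((x - y) / 2) = (0::real)"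
proof -
  have "sin ((y - x) / 2) = - sin ((x - y) / 2)"
    by (metis minus_diff_eq minus_divide_left sin_minus)
  then show ?thesis by (subst cos_diff_cos) auto
qed

text \<open>In the half-sum and half-difference of the angles, \<open>cos y - cos x\<close> is a
  product of two sines; the hypothesis says that neither sine vanishes, so both cotangents are
  genuine.\<close>

lemma cot_diff_eq:
  fixes x y :: real
  assumes "cos x \<noteq> cos y"
  shows "cot ((x + y) / 2) - cot ((x - y) / 2) = - 2 * (sin y / (cos y - cos x))"
proof -
  define u v where "u = (x + y) / 2" and "v = (x - y) / 2"
  have uv: "x = u + v" "y = u - v" by (auto simp: u_def v_def field_simps)
  have nz: "sin u \<noteq> 0" "sin v \<noteq> 0"
    using assms cos_diff_eq_zero_iff[of x y] by (auto simp: u_def v_def)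
  have "cos y - cos x = 2 * sin u * sin v" unfolding uv by (simp add: cos_add cos_diff)
  moreover have "sin y = sin u * cos v - cos u * sin v" unfolding uv by (simp add: sin_diff)
  ultimately show ?thesis
    unfolding u_def[symmetric] v_def[symmetric] cot_def using nz by (simp add: divide_simps)
qed

text \<open>Each term is a difference of cotangents whose arguments differ by \<open>pi / n\<close>,
  and passing from \<open>k\<close> to \<open>k + 1\<close> shifts both arguments by the same
  \<open>pi / n\<close>, so the sum telescopes.\<close>

lemma sum_inverse_cos_diff_eq_0:
  fixes n :: nat and t :: real
  assumes n: "n > 0" and ne: "\<And>k. k < n \<Longrightarrow> cos (t + 2 * pi / n * real k) \<noteq> cos (pi / n)"
  shows "(\<Sum>k<n. sin (pi / n) / (cos (pi / n) - cos (t + 2 * pi / n * real k))) = 0"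
proof -
  define g where "g k = cot ((t - pi / n) / 2 + pi / n * real k)" for k :: nat
  have step: "sin (pi / n) / (cos (pi / n) - cos (t + 2 * pi / n * real k)) = - (g (Suc k) - g k) / 2"
    if k: "k < n" for k
  proof -
    have "(t + 2 * pi / n * real k + pi / n) / 2 = (t - pi / n) / 2 + pi / n * real (Suc k)"
      "(t + 2 * pi / n * real k - pi / n) / 2 = (t - pi / n) / 2 + pi / n * real k"
      using n by (simp_all add: field_simps)
    then have "g (Suc k) - g k
        = - 2 * (sin (pi / n) / (cos (pi / n) - cos (t + 2 * pi / n * real k)))"
      unfolding g_def using cot_diff_eq[OF ne[OF k]] by (simp only:)
    moreover have "x = - y / 2" if "y = - 2 * x" for x y :: real using that by simp
    ultimately show ?thesis by blast
  qed
  have "(\<Sum>k<n. sin (pi / n) / (cos (pi / n) - cos (t + 2 * pi / n * real k)))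
      = (\<Sum>k<n. - (g (Suc k) - g k) / 2)"
    by (rule sum.cong) (use step in auto)
  also have "\<dots> = - (\<Sum>k<n. g (Suc k) - g k) / 2"
    by (simp only: sum_divide_distrib sum_negf[symmetric])
  also have "\<dots> = - (g n - g 0) / 2"
    by (simp only: sum_lessThan_telescope)
  \<comment> \<open>After \<open>n\<close> steps the argument has grown by exactly pi, the period of
    the cotangent.\<close>
  also have "g n = g 0"
    using n unfolding g_def cot_def by simp
  finally show ?thesis by simp
qed

subsection \<open>Arc length\<close>

lemma space_circle_borel [simp]: "space circle_borel = sphere 0 1"
  by (simp add: circle_borel_def space_restrict_space)

lemma sets_circle_borel: "sets circle_borel = {A \<in> sets borel. A \<subseteq> sphere 0 1}"
  unfolding circle_borel_def sets_restrict_space by (auto simp: image_iff)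

lemma measurable_cis [measurable]: "cis \<in> borel_measurable borel"
  by (intro borel_measurable_continuous_onI continuous_on_cis continuous_on_id)

lemma measurable_cnj [measurable]: "cnj \<in> borel_measurable borel"
  by (intro borel_measurable_continuous_onI continuous_intros)

lemma measurable_cis_circle: "cis \<in> restrict_space lborel {-pi<..pi} \<rightarrow>\<^sub>M circle_borel"
  unfolding circle_borel_def
  by (intro measurable_restrict_space2 measurable_restrict_space1) auto

lemma sets_arc_length_measure [simp, measurable_cong]: "sets arc_length_measure = sets circle_borel"
  by (simp add: arc_length_measure_def)

lemma space_arc_length_measure [simp]: "space arc_length_measure = sphere 0 1"
  by (simp add: arc_length_measure_def)

lemma borel_measurable_circle:
  "H \<in> borel_measurable borel \<Longrightarrow> H \<in> borel_measurable circle_borel"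
  unfolding circle_borel_def by (rule measurable_restrict_space1)

lemma nn_integral_arc_length:
  assumes "H \<in> borel_measurable circle_borel"
  shows "(\<integral>\<^sup>+z. H z \<partial>arc_length_measure) = (\<integral>\<^sup>+x. H (cis x) * indicator {-pi<..pi} x \<partial>lborel)"
  unfolding arc_length_measure_def
  by (subst nn_integral_distr[OF measurable_cis_circle]) (auto simp: assms nn_integral_restrict_space)

lemma nn_integral_lborel_shift:
  fixes h :: "real \<Rightarrow> ennreal"
  assumes "h \<in> borel_measurable borel"
  shows "(\<integral>\<^sup>+x. h (c + x) \<partial>lborel) = (\<integral>\<^sup>+x. h x \<partial>lborel)"
  using nn_integral_real_affine[OF assms, of 1 c] by simp

text \<open>In angles a rotation is a translation of the window (-pi, pi]; the piece pushed beyond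
  pi is carried back by periodicity. Taking \<open>c\<close> in [0, 2 pi) makes the overflow
  one-sided.\<close>

lemma nn_integral_rotate:
  assumes H [measurable]: "H \<in> borel_measurable borel" and e: "norm e = 1"
  shows "(\<integral>\<^sup>+z. H (e * z) \<partial>arc_length_measure) = (\<integral>\<^sup>+z. H z \<partial>arc_length_measure)"
proof -
  define c where "c = Arg2pi e"
  have c: "0 \<le> c" "c < 2 * pi" and ec: "e = cis c"
    using Arg2pi[of e] e by (auto simp: c_def cis_conv_exp is_Arg_def)
  let ?h = "\<lambda>x. H (cis x)"
  have [measurable]: "(\<lambda>z. H (e * z)) \<in> borel_measurable borel" by measurable
  have period: "?h (2 * pi + x) = ?h x" for x
    by (simp flip: cis_mult)
  have "(\<integral>\<^sup>+z. H (e * z) \<partial>arc_length_measure)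
      = (\<integral>\<^sup>+x. ?h (c + x) * indicator {c-pi<..c+pi} (c + x) \<partial>lborel)"
    by (subst nn_integral_arc_length)
      (auto simp: ec[symmetric] intro: borel_measurable_circle,
       auto simp: ec cis_mult split: split_indicator intro!: nn_integral_cong)
  also have "\<dots> = (\<integral>\<^sup>+x. ?h x * indicator {c-pi<..c+pi} x \<partial>lborel)"
    by (rule nn_integral_lborel_shift[of "\<lambda>x. ?h x * indicator {c-pi<..c+pi} x"]) measurable
  also have "\<dots> = (\<integral>\<^sup>+x. ?h x * indicator {c-pi<..pi} x + ?h x * indicator {pi<..c+pi} x \<partial>lborel)"
    using c by (intro nn_integral_cong) (auto split: split_indicator)
  also have "\<dots> = (\<integral>\<^sup>+x. ?h x * indicator {c-pi<..pi} x \<partial>lborel)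
      + (\<integral>\<^sup>+x. ?h x * indicator {pi<..c+pi} x \<partial>lborel)"
    by (rule nn_integral_add) measurable
  also have "(\<integral>\<^sup>+x. ?h x * indicator {pi<..c+pi} x \<partial>lborel)
      = (\<integral>\<^sup>+x. ?h (2 * pi + x) * indicator {pi<..c+pi} (2 * pi + x) \<partial>lborel)"
    by (rule nn_integral_lborel_shift[of "\<lambda>x. ?h x * indicator {pi<..c+pi} x", symmetric]) measurable
  also have "\<dots> = (\<integral>\<^sup>+x. ?h x * indicator {-pi<..c-pi} x \<partial>lborel)"
    unfolding period by (auto split: split_indicator intro!: nn_integral_cong)
  also have "(\<integral>\<^sup>+x. ?h x * indicator {c-pi<..pi} x \<partial>lborel)
      + (\<integral>\<^sup>+x. ?h x * indicator {-pi<..c-pi} x \<partial>lborel)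
      = (\<integral>\<^sup>+x. ?h x * indicator {c-pi<..pi} x + ?h x * indicator {-pi<..c-pi} x \<partial>lborel)"
    by (rule nn_integral_add[symmetric]) measurable
  also have "\<dots> = (\<integral>\<^sup>+x. ?h x * indicator {-pi<..pi} x \<partial>lborel)"
    using c by (intro nn_integral_cong) (auto split: split_indicator)
  also have "\<dots> = (\<integral>\<^sup>+z. H z \<partial>arc_length_measure)"
    by (subst nn_integral_arc_length) (auto intro: borel_measurable_circle)
  finally show ?thesis .
qed

lemma nn_integral_reflect:
  assumes H [measurable]: "H \<in> borel_measurable borel"
  shows "(\<integral>\<^sup>+z. H (cnj z) \<partial>arc_length_measure) = (\<integral>\<^sup>+z. H z \<partial>arc_length_measure)"
proof -
  have [measurable]: "(\<lambda>z. H (cnj z)) \<in> borel_measurable borel" by measurable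
  have "(\<integral>\<^sup>+z. H z \<partial>arc_length_measure) = (\<integral>\<^sup>+x. H (cis x) * indicator {-pi<..pi} x \<partial>lborel)"
    by (subst nn_integral_arc_length) (auto intro: borel_measurable_circle)
  also have "\<dots> = (\<integral>\<^sup>+x. H (cis (- x)) * indicator {-pi<..pi} (- x) \<partial>lborel)"
    using nn_integral_real_affine[of "\<lambda>x. H (cis x) * indicator {-pi<..pi} x" "-1" 0] by simp
  \<comment> \<open>Reflection turns (-pi, pi] into [-pi, pi); the two integrands can differ only at
    the null points pi and -pi.\<close>
  also have "\<dots> = (\<integral>\<^sup>+x. H (cnj (cis x)) * indicator {-pi<..pi} x \<partial>lborel)"
  proof (rule nn_integral_cong_AE)
    show "AE x in lborel. H (cis (- x)) * indicator {-pi<..pi} (- x)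
        = H (cnj (cis x)) * indicator {-pi<..pi} x"
      using AE_lborel_singleton[of pi] AE_lborel_singleton[of "-pi"]
      by eventually_elim (auto simp: cis_cnj split: split_indicator)
  qed
  also have "\<dots> = (\<integral>\<^sup>+z. H (cnj z) \<partial>arc_length_measure)"
    by (subst nn_integral_arc_length) (auto intro: borel_measurable_circle)
  finally show ?thesis by simp
qed

lemma AE_arc_length_neq: "AE z in arc_length_measure. z \<noteq> w"
proof -
  have "{x \<in> sphere 0 1. x \<noteq> w} = sphere 0 1 - {w}" by auto
  then have *: "{x \<in> space circle_borel. x \<noteq> w} \<in> sets circle_borel"
    by (auto simp: sets_circle_borel)
  have "AE x in lborel. x \<in> {-pi<..pi} \<longrightarrow> cis x \<noteq> w"
    using AE_lborel_singleton[of "Arg w"]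
    by eventually_elim (auto simp: Arg_cis)
  then show ?thesis
    unfolding arc_length_measure_def
    by (subst AE_distr_iff[OF measurable_cis_circle *]) (simp add: AE_restrict_space_iff)
qed

text \<open>This makes the base measure sigma-finite, so that sigma-finiteness of a density can be
  tested by its finiteness almost everywhere.\<close>

lemma finite_measure_arc_length: "finite_measure arc_length_measure"
proof
  have "emeasure arc_length_measure (sphere 0 1) = (\<integral>\<^sup>+z. 1 \<partial>arc_length_measure)"
    by simp
  also have "\<dots> = emeasure lborel {-pi<..pi}"
    by (subst nn_integral_arc_length) (auto intro: borel_measurable_circle)
  finally show "emeasure arc_length_measure (space arc_length_measure) \<noteq> \<infinity>" by simp
qed

subsection \<open>The chord involution\<close>

text \<open>The Cayley parametrisation of the circle without -1, which turns the later angle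
  computations into rational ones.\<close>

lemma cis_arctan:
  "cis (2 * arctan x) = (1 + \<i> * of_real x) / (1 - \<i> * of_real x)"
proof -
  have pos: "1 + x\<^sup>2 > 0" by (simp add: add_pos_nonneg)
  have "cos (2 * arctan x) = (1 - x\<^sup>2) / (1 + x\<^sup>2)"
    using cos_tan_half[of "arctan x"] by (simp add: tan_arctan)
  moreover have "sin (2 * arctan x) = 2 * x / (1 + x\<^sup>2)"
    using sin_tan_half[of "arctan x"] by (simp add: tan_arctan)
  ultimately show ?thesis
    using pos by (simp add: complex_eq_iff Re_divide Im_divide power2_eq_square)
qed

text \<open>The involution of the circle that swaps the two intersection points with a line through
  \<open>1 / C\<close>.\<close>

definition chord_map :: "real \<Rightarrow> complex \<Rightarrow> complex" where
  "chord_map C z = (1 - of_real C * z) / (of_real C - z)"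

lemma measurable_chord_map [measurable]: "chord_map C \<in> borel_measurable borel"
  unfolding chord_map_def[abs_def] by measurable

text \<open>In the half-angle coordinate the chord map is \<open>x \<mapsto> s^2 / x\<close>. At
  \<open>x = s^2 * t\<close> it yields \<open>1 / t\<close>, the coordinate of the angle
  \<open>pi - 2 * arctan t\<close>; the right-hand side writes that point without the pole at
  \<open>t = 0\<close>.\<close>

lemma chord_map_cis_arctan:
  fixes s t :: real
  defines "C \<equiv> (1 - s\<^sup>2) / (1 + s\<^sup>2)"
  assumes s: "s > 0"
  shows "chord_map C (cis (2 * arctan (s\<^sup>2 * t))) = - cis (- (2 * arctan t))"
proof -
  let ?x = "s\<^sup>2 * t"
  have pos: "1 + s\<^sup>2 > 0" by (simp add: add_pos_nonneg)
  have nz: "1 - \<i> * of_real y \<noteq> 0" "1 + \<i> * of_real y \<noteq> 0" for y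
    by (auto simp: complex_eq_iff)
  have C: "of_real C = (1 - of_real s ^ 2) / (1 + of_real s ^ 2 :: complex)"
    by (simp add: C_def)
  have pos': "1 + of_real s ^ 2 \<noteq> (0::complex)"
    using pos by (metis of_real_1 of_real_add of_real_eq_0_iff of_real_power less_irrefl)
  have s0: "of_real s \<noteq> (0::complex)" using s by simp
  \<comment> \<open>Numerator and denominator share all factors except \<open>1 - \<i> * t\<close>,
    \<open>1 + \<i> * t\<close> and a sign, so only these survive in the quotient.\<close>
  have num: "1 - of_real C * cis (2 * arctan ?x)
      = 2 * of_real s ^ 2 * (1 - \<i> * of_real t) / ((1 + of_real s ^ 2) * (1 - \<i> * of_real ?x))"
    unfolding cis_arctan C using pos' nz[of ?x] by (simp add: divide_simps) (simp add: algebra_simps)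
  have den: "of_real C - cis (2 * arctan ?x)
      = - 2 * of_real s ^ 2 * (1 + \<i> * of_real t) / ((1 + of_real s ^ 2) * (1 - \<i> * of_real ?x))"
    unfolding cis_arctan C using pos' nz[of ?x] by (simp add: divide_simps) (simp add: algebra_simps)
  have image: "- cis (- (2 * arctan t)) = - ((1 - \<i> * of_real t) / (1 + \<i> * of_real t))"
    using cis_arctan[of "- t"] by (simp add: arctan_minus)
  show ?thesis
    unfolding chord_map_def num den image using pos' nz[of ?x] nz[of t] s0
    by (simp add: divide_simps)
qed

lemma cos_sin_tan_half:
  fixes a :: real
  assumes "cos (a / 2) \<noteq> 0"
  shows "cos a = (1 - (tan (a / 2))\<^sup>2) / (1 + (tan (a / 2))\<^sup>2)"
    and "sin a = 2 * tan (a / 2) / (1 + (tan (a / 2))\<^sup>2)"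
  using cos_tan_half[OF assms] sin_tan_half[of "a / 2"] by simp_all

text \<open>With \<open>t = tan (x / 2)\<close> the second factor is the derivative of
  \<open>2 * arctan (s^2 * tan (x / 2))\<close> in \<open>x\<close>; this is the Jacobian identity
  for the two densities.\<close>

lemma substitution_density:
  fixes s t :: real
  defines "C \<equiv> (1 - s\<^sup>2) / (1 + s\<^sup>2)" and "S \<equiv> 2 * s / (1 + s\<^sup>2)"
  assumes s: "s > 0"
  shows "S / (cos (2 * arctan (s\<^sup>2 * t)) - C) * (s\<^sup>2 * (1 + t\<^sup>2) / (1 + (s\<^sup>2 * t)\<^sup>2))
     = S / (C + cos (2 * arctan t))"
proof -
  have cos2: "cos (2 * arctan x) = (1 - x\<^sup>2) / (1 + x\<^sup>2)" for x :: real
    using cos_tan_half[of "arctan x"] by (simp add: tan_arctan)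
  let ?x = "s\<^sup>2 * t"
  have p: "1 + s\<^sup>2 > 0" "1 + t\<^sup>2 > 0" "1 + ?x\<^sup>2 > 0"
    by (simp_all add: add_pos_nonneg)
  have 1: "cos (2 * arctan ?x) - C = 2 * s\<^sup>2 * (1 - s\<^sup>2 * t\<^sup>2) / ((1 + s\<^sup>2) * (1 + ?x\<^sup>2))"
    unfolding C_def cos2 using p by (simp add: divide_simps) (simp add: algebra_simps eval_nat_numeral)
  have 2: "C + cos (2 * arctan t) = 2 * (1 - s\<^sup>2 * t\<^sup>2) / ((1 + s\<^sup>2) * (1 + t\<^sup>2))"
    unfolding C_def cos2 using p by (simp add: divide_simps) (simp add: algebra_simps eval_nat_numeral)
  \<comment> \<open>If \<open>s^2 * t^2 = 1\<close>, both cosine expressions vanish and both sides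
    are 0 by the convention for division by zero.\<close>
  show ?thesis
    unfolding 1 2 using p s by (cases "1 - s\<^sup>2 * t\<^sup>2 = 0") (simp_all add: divide_simps)
qed

text \<open>With \<open>x = tan (\<phi> / 2)\<close> the chord map becomes \<open>x \<mapsto> s\<^sup>2 / x\<close>; replacing the image angle
  \<open>\<psi>\<close> by \<open>\<eta> = pi - \<psi>\<close> removes the pole, since \<open>x = s\<^sup>2 tan (\<eta> / 2)\<close>.\<close>

lemma nn_integral_chord_substitution:
  fixes a :: real and H :: "complex \<Rightarrow> ennreal"
  defines "C \<equiv> cos a" and "S \<equiv> sin a"
  assumes a: "0 < a" "a < pi" and H [measurable]: "H \<in> borel_measurable borel"
  shows "(\<integral>\<^sup>+x. ennreal (S / (cos x - C)) * H (chord_map C (cis x)) * indicator {-a..a} x \<partial>lborel)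
    = (\<integral>\<^sup>+x. ennreal (S / (C + cos x)) * H (- cis (- x)) * indicator {-(pi-a)..pi-a} x \<partial>lborel)"
proof -
  define s where "s = tan (a / 2)"
  define b where "b = pi - a"
  define g where "g x = 2 * arctan (s\<^sup>2 * tan (x / 2))" for x
  define g' where "g' x = s\<^sup>2 * (1 + (tan (x / 2))\<^sup>2) / (1 + (s\<^sup>2 * tan (x / 2))\<^sup>2)" for x
  have c0: "cos (a / 2) > 0" using a by (intro cos_gt_zero) auto
  have s: "s > 0" unfolding s_def using a by (intro tan_gt_zero) auto
  have C: "C = (1 - s\<^sup>2) / (1 + s\<^sup>2)" and S: "S = 2 * s / (1 + s\<^sup>2)"
    using cos_sin_tan_half[of a] c0 by (simp_all add: C_def S_def s_def)
  have b: "0 < b" "b < pi" using a by (auto simp: b_def)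
  have cosx: "cos (x / 2) > 0" if "x \<in> {-b..b}" for x
    using that b by (intro cos_gt_zero_pi) auto
  have pos: "1 + (s\<^sup>2 * t)\<^sup>2 > 0" for t by (simp add: add_pos_nonneg)
  have pos0: "1 + (s\<^sup>2 * t)\<^sup>2 \<noteq> 0" for t using pos[of t] by simp
  \<comment> \<open>Since \<open>b / 2\<close> is complementary to \<open>a / 2\<close>,
    \<open>s^2 * tan (b / 2) = s\<close>: the endpoints -b and b go to -a and a.\<close>
  have "tan (b / 2) = 1 / s"
    unfolding b_def s_def by (simp add: diff_divide_distrib tan_cot inverse_eq_divide)
  then have gb: "g b = a"
    unfolding g_def using s a by (simp add: power2_eq_square) (simp add: s_def arctan_tan)
  have gb': "g (- b) = - a" using gb by (simp add: g_def arctan_minus)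
  have deriv: "(g has_real_derivative g' x) (at x)" if "x \<in> {-b..b}" for x
  proof -
    have "1 + (tan (x / 2))\<^sup>2 = 1 / (cos (x / 2))\<^sup>2"
      using tan_sec[of "x / 2"] cosx[OF that] by (simp add: inverse_eq_divide power_divide)
    then show ?thesis
      unfolding g_def g'_def using cosx[OF that] pos
      by (auto intro!: derivative_eq_intros simp: power_mult_distrib divide_simps)
  qed
  have cont: "continuous_on {-b..b} g'"
    unfolding g'_def using cosx pos0
    by (intro continuous_intros) force+
  have nonneg: "g' x \<ge> 0" for x unfolding g'_def using pos by (simp add: less_imp_le)
  define F where "F x = ennreal (S / (cos x - C)) * H (chord_map C (cis x))" for x
  have [measurable]: "F \<in> borel_measurable borel" unfolding F_def by measurable
  have "(\<integral>\<^sup>+x. F x * indicator {g (-b)..g b} x \<partial>lborel)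
      = (\<integral>\<^sup>+x. F (g x) * g' x * indicator {-b..b} x \<partial>lborel)"
    by (rule nn_integral_substitution_aux) (use deriv cont nonneg b in auto)
  also have "\<dots> = (\<integral>\<^sup>+x. ennreal (S / (C + cos x)) * H (- cis (- x)) * indicator {-b..b} x \<partial>lborel)"
  proof (rule nn_integral_cong)
    fix x :: real
    show "F (g x) * g' x * indicator {-b..b} x
        = ennreal (S / (C + cos x)) * H (- cis (- x)) * indicator {-b..b} x"
    proof (cases "x \<in> {-b..b}")
      case True
      have x: "2 * arctan (tan (x / 2)) = x" using True b by (simp add: arctan_tan)
      have "chord_map C (cis (g x)) = - cis (- x)"
        using chord_map_cis_arctan[OF s, of "tan (x / 2)"] unfolding g_def C x by simp
      moreover have "S / (cos (g x) - C) * g' x = S / (C + cos x)"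
        using substitution_density[OF s, of "tan (x / 2)"] unfolding g_def g'_def C S x by simp
      ultimately show ?thesis
        unfolding F_def using nonneg[of x]
        by (metis ennreal_mult'' mult.assoc mult.commute)
    qed simp
  qed
  finally show ?thesis unfolding gb gb' F_def by (simp add: b_def)
qed

text \<open>The substitution parametrises the image by pi minus its angle, so the image point is
  \<open>- cnj (cis x)\<close>. Invariance of arc length under reflection and under rotation by -1
  then restores \<open>z\<close>; the cap endpoints are null.\<close>

lemma nn_integral_chord_map:
  fixes a :: real and H :: "complex \<Rightarrow> ennreal"
  defines "C \<equiv> cos a" and "S \<equiv> sin a"
  assumes a: "0 < a" "a < pi" and H [measurable]: "H \<in> borel_measurable borel"
  shows "(\<integral>\<^sup>+z. ennreal (S / (Re z - C)) * indicator {z. C < Re z} z * H (chord_map C z) \<partial>arc_length_measure)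
    = (\<integral>\<^sup>+z. ennreal (S / (C - Re z)) * indicator {z. Re z < C} z * H z \<partial>arc_length_measure)"
proof -
  define F where "F z = ennreal (S / (C - Re z)) * indicator {z. Re z < C} z * H z" for z
  have F [measurable]: "F \<in> borel_measurable borel" unfolding F_def by measurable
  have "(\<integral>\<^sup>+z. ennreal (S / (Re z - C)) * indicator {z. C < Re z} z * H (chord_map C z) \<partial>arc_length_measure)
      = (\<integral>\<^sup>+x. ennreal (S / (cos x - C)) * indicator {z. C < Re z} (cis x) * H (chord_map C (cis x))
            * indicator {-pi<..pi} x \<partial>lborel)"
    by (subst nn_integral_arc_length) (auto intro!: borel_measurable_circle)
  also have "\<dots> = (\<integral>\<^sup>+x. ennreal (S / (cos x - C)) * H (chord_map C (cis x)) * indicator {-a..a} x \<partial>lborel)"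
  proof (rule nn_integral_cong_AE)
    show "AE x in lborel. ennreal (S / (cos x - C)) * indicator {z. C < Re z} (cis x)
        * H (chord_map C (cis x)) * indicator {-pi<..pi} x
      = ennreal (S / (cos x - C)) * H (chord_map C (cis x)) * indicator {-a..a} x"
      using AE_lborel_singleton[of a] AE_lborel_singleton[of "- a"]
    proof eventually_elim
      case (elim x)
      have "(C < cos x \<and> -pi < x \<and> x \<le> pi) \<longleftrightarrow> -a \<le> x \<and> x \<le> a"
        using cos_less_cos_iff_abs[of a x] a elim unfolding C_def by (auto simp: abs_le_iff)
      then show ?case by (auto split: split_indicator)
    qed
  qed
  also have "\<dots> = (\<integral>\<^sup>+x. ennreal (S / (C + cos x)) * H (- cis (- x)) * indicator {-(pi-a)..pi-a} x \<partial>lborel)"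
    unfolding C_def S_def by (rule nn_integral_chord_substitution) (use a in auto)
  also have "\<dots> = (\<integral>\<^sup>+x. F (- cnj (cis x)) * indicator {-pi<..pi} x \<partial>lborel)"
  proof (rule nn_integral_cong_AE)
    show "AE x in lborel. ennreal (S / (C + cos x)) * H (- cis (- x)) * indicator {-(pi-a)..pi-a} x
      = F (- cnj (cis x)) * indicator {-pi<..pi} x"
      using AE_lborel_singleton[of "pi - a"] AE_lborel_singleton[of "a - pi"]
    proof eventually_elim
      case (elim x)
      have "(- cos x < C \<and> -pi < x \<and> x \<le> pi) \<longleftrightarrow> -(pi-a) \<le> x \<and> x \<le> pi-a"
        using cos_less_cos_iff_abs[of "pi - a" x] a elim unfolding C_def by (auto simp: abs_le_iff)
      then show ?case unfolding F_def cis_cnj by (auto split: split_indicator)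
    qed
  qed
  also have "\<dots> = (\<integral>\<^sup>+z. F (- cnj z) \<partial>arc_length_measure)"
    by (subst nn_integral_arc_length) (auto intro!: borel_measurable_circle)
  also have "\<dots> = (\<integral>\<^sup>+z. F (- z) \<partial>arc_length_measure)"
    by (rule nn_integral_reflect[of "\<lambda>z. F (- z)"]) measurable
  also have "\<dots> = (\<integral>\<^sup>+z. F z \<partial>arc_length_measure)"
    using nn_integral_rotate[OF F, of "-1"] by simp
  finally show ?thesis unfolding F_def .
qed

subsection \<open>Circumscribed regular polygons\<close>

text \<open>The tangency point is the foot of the perpendicular from 0, so Pythagoras gives both
  tangent lengths; they add because it lies between \<open>p\<close> and \<open>q\<close>.\<close>

lemma tangent_segment_length:
  fixes p q A :: "'a::euclidean_space"
  assumes A: "affine hull {p, q} \<inter> sphere 0 1 = {A}" "A \<in> closed_segment p q"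
    and pq: "p \<noteq> q"
  shows "dist p q = sqrt ((norm p)\<^sup>2 - 1) + sqrt ((norm q)\<^sup>2 - 1)"
proof -
  define d where "d = q - p"
  have d: "d \<bullet> d > 0" using pq by (simp add: d_def)
  obtain u where u: "0 \<le> u" "u \<le> 1" "A = p + u *\<^sub>R d"
    using A(2) by (auto simp: in_segment d_def algebra_simps)
  have hull: "A + t *\<^sub>R d \<in> affine hull {p, q}" for t
    unfolding affine_hull_2_alt u(3) by (auto intro!: image_eqI[of _ _ "u + t"] simp: d_def algebra_simps)
  have A1: "A \<bullet> A = 1" using A(1) by (auto simp: norm_eq_1)
  have orth: "A \<bullet> d = 0"
  proof -
    \<comment> \<open>This parameter gives the other root of the quadratic for the line and the
      circle. Uniqueness of the intersection forces it to be 0, which is orthogonality.\<close>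
    define t where "t = - 2 * (A \<bullet> d) / (d \<bullet> d)"
    have "(A + t *\<^sub>R d) \<bullet> (A + t *\<^sub>R d) = 1 + t * (2 * (A \<bullet> d) + t * (d \<bullet> d))"
      using A1 by (simp add: inner_add_left inner_add_right inner_commute algebra_simps)
    also have "2 * (A \<bullet> d) + t * (d \<bullet> d) = 0" using d by (simp add: t_def)
    finally have "A + t *\<^sub>R d \<in> affine hull {p, q} \<inter> sphere 0 1"
      using hull by (simp add: norm_eq_1)
    then have "t *\<^sub>R d = 0" unfolding A(1) by simp
    then show ?thesis using d by (auto simp: t_def)
  qed
  have pyth: "(norm (A + t *\<^sub>R d))\<^sup>2 - 1 = (t * norm d)\<^sup>2" for t
    using A1 orth by (simp add: power2_norm_eq_inner inner_add_left inner_add_right inner_commute power_mult_distrib)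
      (simp add: power2_eq_square)
  have "p = A + (- u) *\<^sub>R d" "q = A + (1 - u) *\<^sub>R d"
    using u by (auto simp: d_def algebra_simps)
  then have "(norm p)\<^sup>2 - 1 = (u * norm d)\<^sup>2" "(norm q)\<^sup>2 - 1 = ((1 - u) * norm d)\<^sup>2"
    using pyth[of "- u"] pyth[of "1 - u"] by simp_all
  then have "sqrt ((norm p)\<^sup>2 - 1) + sqrt ((norm q)\<^sup>2 - 1) = u * norm d + (1 - u) * norm d"
    using u by simp
  also have "\<dots> = norm d" by (simp add: algebra_simps)
  finally show ?thesis by (simp add: d_def dist_norm norm_minus_commute)
qed

lemma norm_power2_add:
  "(norm (c + z))\<^sup>2 = (norm c)\<^sup>2 + (norm z)\<^sup>2 + 2 * Re (cnj c * z)"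
  unfolding cmod_power2 by (simp add: power2_eq_square algebra_simps)

text \<open>The two tangent lengths at a vertex agree and consecutive ones add up to the side length, so
  vertices of the same parity are equidistant from \<open>0\<close>; this centres the polygon at \<open>0\<close>.\<close>

lemma regular_polygon_centre_radius:
  assumes n: "n \<ge> 3" and z: "\<zeta> \<in> {cis (2 * pi / real n), cis (- (2 * pi / real n))}"
    and w: "w \<noteq> 0" and P: "\<And>j. P j = c + w * \<zeta> powi j" and circ: "circumscribed P"
  shows "c = 0" and "norm w = 1 / cos (pi / n)"
proof -
  have n2: "0 < 2 * pi / n" "2 * pi / n < pi" using n by (auto simp: field_simps)
  then have "sin (2 * pi / n) > 0" by (intro sin_gt_zero)
  then have Im0: "Im \<zeta> \<noteq> 0" using z by auto
  then have z1: "\<zeta> \<noteq> 1" "\<zeta>\<^sup>2 \<noteq> 1" by (auto simp: power2_eq_1_iff)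
  have nz: "norm \<zeta> = 1" using z by auto
  then have z0: "\<zeta> \<noteq> 0" by auto
  define t where "t j = sqrt ((norm (P j))\<^sup>2 - 1)" for j
  have side: "t j + t (j + 1) = norm w * norm (1 - \<zeta>)" for j
  proof -
    have diff: "P j - P (j + 1) = w * \<zeta> powi j * (1 - \<zeta>)"
      unfolding P using z0 by (simp add: power_int_add algebra_simps)
    then have "P j - P (j + 1) \<noteq> 0" using w z0 z1 by simp
    then have "dist (P j) (P (j + 1)) = t j + t (j + 1)"
      using circ tangent_segment_length[of "P j" "P (j + 1)"] unfolding circumscribed_def t_def by auto
    then show ?thesis
      unfolding dist_norm diff by (simp add: norm_mult norm_power_int nz)
  qed
  have "t j = t (j + 2)" for j using side[of j] side[of "j + 1"] by (simp add: add.commute)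
  then have parity: "(norm (P j))\<^sup>2 = (norm (P (j + 2)))\<^sup>2" for j by (simp add: t_def)
  \<comment> \<open>Equal norms at vertices two apart make the real parts of \<open>v\<close> and
    \<open>v * \<zeta>\<close> vanish. As \<open>n \<ge> 3\<close> makes \<open>\<zeta>\<close>
    non-real, 1 and \<open>\<zeta>\<close> span the plane over the reals, hence
    \<open>v = 0\<close>.\<close>
  define v where "v = cnj c * w * (1 - \<zeta>\<^sup>2)"
  have norms: "(norm (w * \<zeta> ^ j))\<^sup>2 = (norm w)\<^sup>2" for j by (simp add: norm_mult norm_power nz)
  have "(norm (c + w * \<zeta> ^ 0))\<^sup>2 = (norm (c + w * \<zeta> ^ 2))\<^sup>2"
    "(norm (c + w * \<zeta> ^ 1))\<^sup>2 = (norm (c + w * \<zeta> ^ 3))\<^sup>2"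
    using parity[of 0] parity[of 1] by (simp_all add: P)
  then have "Re (cnj c * (w * \<zeta> ^ 0)) = Re (cnj c * (w * \<zeta> ^ 2))"
    "Re (cnj c * (w * \<zeta> ^ 1)) = Re (cnj c * (w * \<zeta> ^ 3))"
    unfolding norm_power2_add norms by linarith+
  moreover have "v = cnj c * (w * \<zeta> ^ 0) - cnj c * (w * \<zeta> ^ 2)"
    "v * \<zeta> = cnj c * (w * \<zeta> ^ 1) - cnj c * (w * \<zeta> ^ 3)"
    by (simp_all add: v_def algebra_simps eval_nat_numeral)
  ultimately have "Re v = 0" "Re (v * \<zeta>) = 0" by simp_all
  then have "v = 0" using Im0 by (auto simp: complex_eq_iff)
  then show c: "c = 0" using w z1 by (auto simp: v_def)
  \<comment> \<open>With the centre at 0 each tangent length is half a side. The side is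
    \<open>2 * norm w * sin (pi / n)\<close>, which determines the radius.\<close>
  have "norm (P j) = norm w" for j
    unfolding P c by (simp add: norm_mult norm_power_int nz)
  then have "2 * sqrt ((norm w)\<^sup>2 - 1) = norm w * norm (1 - \<zeta>)"
    using side[of 0] by (simp add: t_def)
  \<comment> \<open>\<open>sqrt\<close> also takes negative values, at negative arguments, so
    squaring it back requires this sign.\<close>
  moreover from this have "sqrt ((norm w)\<^sup>2 - 1) \<ge> 0"
    by (metis mult_nonneg_nonneg norm_ge_zero zero_le_mult_iff zero_less_numeral not_less)
  ultimately have "4 * ((norm w)\<^sup>2 - 1) = (norm w)\<^sup>2 * (norm (1 - \<zeta>))\<^sup>2"
    by (metis (no_types, lifting) four_x_squared power_mult_distrib real_sqrt_ge_0_iff real_sqrt_pow2)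
  also have "(norm (1 - \<zeta>))\<^sup>2 = 4 * (sin (pi / n))\<^sup>2"
  proof -
    have "(norm (1 - \<zeta>))\<^sup>2 = 2 - 2 * cos (2 * (pi / n))"
    proof -
      have "(1 - cos x)\<^sup>2 + (sin x)\<^sup>2 = 2 - 2 * cos x" for x :: real
        using sin_cos_squared_add[of x] by (simp add: power2_eq_square algebra_simps)
      then show ?thesis using z by (auto simp: cmod_power2)
    qed
    also have "\<dots> = 4 * (sin (pi / n))\<^sup>2" by (subst cos_double_sin) simp
    finally show ?thesis .
  qed
  finally have "(norm w)\<^sup>2 * (1 - (sin (pi / n))\<^sup>2) = 1" by (simp add: algebra_simps)
  then have "(norm w * cos (pi / n))\<^sup>2 = 1" by (simp add: cos_squared_eq power_mult_distrib)
  moreover have C: "cos (pi / n) > 0" using n by (intro cos_gt_zero) (auto simp: field_simps)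
  ultimately have "norm w * cos (pi / n) = 1"
    by (simp add: power2_eq_1_iff) (smt (verit) norm_ge_zero mult_nonneg_nonneg)
  then show "norm w = 1 / cos (pi / n)" using C by (simp add: field_simps)
qed

text \<open>A normal form: the orientation and the integer indexing are absorbed, and only the set
  of vertices is retained.\<close>

lemma circumscribed_regular_polygon_vertices:
  assumes reg: "regular_polygon n P" and circ: "circumscribed P"
  obtains \<alpha> where "range P = (\<lambda>k. cis (\<alpha> + 2 * pi / n * real k) / of_real (cos (pi / n))) ` {..<n}"
proof -
  obtain c w \<zeta> where n: "n \<ge> 3" and w: "w \<noteq> 0"
    and z: "\<zeta> \<in> {cis (2 * pi / real n), cis (- (2 * pi / real n))}" and P: "\<And>j. P j = c + w * \<zeta> powi j"
    using reg unfolding regular_polygon_def by blast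
  note c = regular_polygon_centre_radius[OF n z w P circ]
  obtain \<sigma> :: int where s: "\<sigma> = 1 \<or> \<sigma> = -1" "\<zeta> = cis (\<sigma> * (2 * pi / n))"
    using z by (cases "\<zeta> = cis (2 * pi / real n)") (force, fastforce)
  define \<alpha> where "\<alpha> = Arg w"
  define Q where "Q k = cis (\<alpha> + 2 * pi / n * real k) / of_real (cos (pi / n))" for k :: nat
  have "w = of_real (norm w) * cis \<alpha>"
    using rcis_cmod_Arg[of w] by (simp add: rcis_def \<alpha>_def)
  then have P': "P j = cis (\<alpha> + 2 * pi / n * of_int (\<sigma> * j)) / of_real (cos (pi / n))" for j
    unfolding P c(1) s(2) cis_power_int c(2) by (simp add: cis_mult algebra_simps)
  have shift: "cis (\<alpha> + 2 * pi / n * of_int (m + int n * l)) = cis (\<alpha> + 2 * pi / n * of_int m)" for m l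
  proof -
    have "\<alpha> + 2 * pi / n * of_int (m + int n * l) = \<alpha> + 2 * pi / n * of_int m + 2 * pi * of_int l"
      using n by (simp add: field_simps)
    moreover have "cis (x + 2 * pi * of_int l) = cis x" for x
      by (simp add: complex_eq_iff cos_add sin_add)
    ultimately show ?thesis by (simp only:)
  qed
  have "range P = Q ` {..<n}"
  proof (intro equalityI subsetI; elim imageE)
    fix p and j :: int assume p: "p = P j"
    define k where "k = nat (\<sigma> * j mod int n)"
    have k: "k < n" "int k = \<sigma> * j mod int n" using n by (auto simp: k_def nat_less_iff)
    have "\<sigma> * j = int k + int n * (\<sigma> * j div int n)" unfolding k(2) by simp
    then have "cis (\<alpha> + 2 * pi / n * of_int (\<sigma> * j)) = cis (\<alpha> + 2 * pi / n * of_int (int k))"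
      using shift[of "int k" "\<sigma> * j div int n"] by metis
    then have "P j = Q k" unfolding P' Q_def by simp
    then show "p \<in> Q ` {..<n}" using k p by simp
  next
    fix p k assume p: "p = Q k"
    \<comment> \<open>The sign \<open>\<sigma>\<close> is its own inverse, so this index undoes the
      orientation.\<close>
    have "P (\<sigma> * int k) = Q k" unfolding P' Q_def using s(1) by auto
    then show "p \<in> range P" using p by (metis rangeI)
  qed
  then show ?thesis using that unfolding Q_def by blast
qed

text \<open>On the line through \<open>z\<close> with direction \<open>d = p - z\<close> the circle
  equation is quadratic with roots 0 and \<open>m\<close>. The point for \<open>m\<close> becomes a
  rational expression through \<open>z * cnj z = 1\<close>; tangency is the case
  \<open>m = 0\<close>.\<close>

lemma line_inter_unit_circle:
  fixes p z :: complex
  assumes z: "norm z = 1" and p: "norm p > 1"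
  shows "affine hull {p, z} \<inter> sphere 0 1 = {z, (p - z) / (1 - cnj p * z)}"
proof -
  define w where "w = (p - z) / (1 - cnj p * z)"
  define d where "d = p - z"
  define m where "m = - 2 * (z \<bullet> d) / (d \<bullet> d)"
  have d0: "d \<noteq> 0" using p z by (auto simp: d_def)
  then have d: "d \<bullet> d > 0" by simp
  have zz: "z * cnj z = 1" using z by (simp add: complex_norm_square[symmetric])
  have "norm (cnj p * z) > 1" using z p by (simp add: norm_mult)
  then have nz: "1 - cnj p * z \<noteq> 0" by auto
  have circle: "norm (z + u *\<^sub>R d) = 1 \<longleftrightarrow> u = 0 \<or> u = m" for u
  proof -
    have "norm (z + u *\<^sub>R d) = 1 \<longleftrightarrow> (z + u *\<^sub>R d) \<bullet> (z + u *\<^sub>R d) = 1" by (rule norm_eq_1)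
    also have "(z + u *\<^sub>R d) \<bullet> (z + u *\<^sub>R d) = 1 + u * (2 * (z \<bullet> d) + u * (d \<bullet> d))"
      using z by (simp add: norm_eq_1 inner_add_left inner_add_right inner_commute algebra_simps)
    also have "2 * (z \<bullet> d) + u * (d \<bullet> d) = (u - m) * (d \<bullet> d)"
      using d0 by (simp add: m_def algebra_simps)
    also have "1 + u * ((u - m) * (d \<bullet> d)) = 1 \<longleftrightarrow> u = 0 \<or> u = m"
      using d0 by auto
    finally show ?thesis .
  qed
  have inner: "of_real (2 * (x \<bullet> y)) = x * cnj y + cnj x * y" for x y :: complex
    by (simp add: inner_complex_def complex_eq_iff algebra_simps)
  have "of_real (d \<bullet> d) * (z + m *\<^sub>R d) = of_real (d \<bullet> d) * z - of_real (2 * (z \<bullet> d)) * d"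
    using d0 by (simp add: m_def scaleR_conv_of_real algebra_simps)
  also have "of_real (d \<bullet> d) = d * cnj d"
    by (simp add: inner_complex_def complex_eq_iff power2_eq_square algebra_simps)
  also have "d * cnj d * z - of_real (2 * (z \<bullet> d)) * d = - cnj z * d\<^sup>2"
    unfolding inner by (simp add: algebra_simps power2_eq_square)
  finally have "d * (cnj d * (z + m *\<^sub>R d)) = d * (- cnj z * d)"
    by (simp add: power2_eq_square mult.assoc mult.left_commute)
  then have "cnj d * (z + m *\<^sub>R d) = - cnj z * d"
    using d0 by (metis mult_left_cancel)
  then have "z * cnj d * (z + m *\<^sub>R d) = z * (- cnj z * d)"
    by (simp only: mult.assoc)
  then have "z * cnj d * (z + m *\<^sub>R d) = - (z * cnj z) * d"
    by (simp only: mult_minus_left mult_minus_right mult.assoc)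
  moreover have "z * cnj d = - (1 - cnj p * z)"
    using zz by (simp add: d_def algebra_simps)
  ultimately have "(1 - cnj p * z) * (z + m *\<^sub>R d) = d" by (simp add: zz algebra_simps)
  then have m: "z + m *\<^sub>R d = w"
    using nz by (simp add: w_def d_def field_simps)
  have "affine hull {p, z} = range (\<lambda>u. z + u *\<^sub>R d)"
    unfolding d_def by (subst insert_commute) (rule affine_hull_2_alt)
  then have "affine hull {p, z} \<inter> sphere 0 1 = (\<lambda>u. z + u *\<^sub>R d) ` {0, m}"
    using circle z by auto
  then show ?thesis unfolding w_def[symmetric] using m by simp
qed

text \<open>Conjugation by the rotation \<open>e\<close> moves the vertex \<open>e / C\<close> to
  \<open>1 / C\<close> on the real axis.\<close>

lemma chord_map_rotate:
  assumes e: "norm e = 1" and C: "C \<noteq> 0"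
  shows "(e / of_real C - z) / (1 - cnj (e / of_real C) * z) = e * chord_map C (cnj e * z)"
proof -
  have ee: "e * cnj e = 1" using e by (simp add: complex_norm_square[symmetric])
  have "(e / of_real C - z) / (1 - cnj (e / of_real C) * z) = (e - of_real C * z) / (of_real C - cnj e * z)"
    using C by (simp add: divide_simps)
  also have "e - of_real C * z = e * (1 - of_real C * (cnj e * z))"
    using ee by (simp add: algebra_simps)
  finally show ?thesis by (simp add: chord_map_def)
qed

text \<open>From \<open>z * cnj z = 1\<close> and \<open>z + cnj z = 2 * C\<close> the point
  satisfies \<open>z^2 - 2 * C * z + 1 = 0\<close>, which is the fixed-point equation;
  \<open>\<bar>C\<bar> < 1\<close> keeps the denominator nonzero.\<close>

lemma chord_map_fixed:
  assumes "norm z = 1" "Re z = C" "\<bar>C\<bar> < 1"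
  shows "chord_map C z = z"
proof -
  have "z * cnj z = 1" using assms by (simp add: complex_norm_square[symmetric])
  moreover have "z + cnj z = 2 * of_real C" using assms by (simp add: complex_add_cnj)
  ultimately have "1 - of_real C * z = z * (of_real C - z)" by algebra
  moreover have "of_real C \<noteq> z" using assms by (metis less_irrefl norm_of_real)
  ultimately show ?thesis by (simp add: chord_map_def)
qed

text \<open>Dividing by the vertex and multiplying by \<open>cnj e\<close> differ by a positive
  factor only. This replaces \<open>Arg\<close> by a real-linear function of
  \<open>z\<close>.\<close>

lemma cos_signed_angle:
  assumes "norm e = 1" "norm z = 1" "C > 0"
  shows "cos (signed_angle (e / of_real C) z) = Re (cnj e * z)"
proof -
  have "e * cnj e = 1" "e \<noteq> 0" using assms by (auto simp: complex_norm_square[symmetric])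
  then have "1 / e = cnj e" by (simp add: divide_eq_eq mult.commute)
  moreover have "z / (e / of_real C) = of_real C * (1 / e * z)" by simp
  ultimately have "z / (e / of_real C) = of_real C * (cnj e * z)" by (simp only:)
  moreover have "norm (of_real C * (cnj e * z)) = C" using assms by (simp add: norm_mult)
  ultimately show ?thesis
    unfolding signed_angle_def using assms by (subst cos_Arg) auto
qed

lemma abs_signed_angle: "\<bar>signed_angle p z\<bar> \<le> pi"
  using Arg_bounded[of "z / p"] by (auto simp: signed_angle_def abs_le_iff)

lemma facing_arc_iff:
  assumes P: "P j = e / of_real (cos (pi / n))" and e: "norm e = 1" and n: "n \<ge> 3"
  shows "z \<in> facing_arc n P j \<longleftrightarrow> norm z = 1 \<and> cos (pi / n) \<le> Re (cnj e * z)"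
    and "z \<in> open_facing_arc n P j \<longleftrightarrow> norm z = 1 \<and> cos (pi / n) < Re (cnj e * z)"
proof -
  have C: "cos (pi / n) > 0" using n by (intro cos_gt_zero) (auto simp: field_simps)
  have a: "0 \<le> pi / n" "pi / n \<le> pi" using n by (auto simp: field_simps)
  have "\<bar>signed_angle (P j) z\<bar> \<le> pi / n \<longleftrightarrow> cos (pi / n) \<le> cos (signed_angle (P j) z)"
    "\<bar>signed_angle (P j) z\<bar> < pi / n \<longleftrightarrow> cos (pi / n) < cos (signed_angle (P j) z)"
    using cos_mono_le_eq[of "pi / n" "\<bar>signed_angle (P j) z\<bar>"]
      cos_mono_less_eq[of "pi / n" "\<bar>signed_angle (P j) z\<bar>"] a abs_signed_angle[of "P j" z] by auto
  then show "z \<in> facing_arc n P j \<longleftrightarrow> norm z = 1 \<and> cos (pi / n) \<le> Re (cnj e * z)"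
    "z \<in> open_facing_arc n P j \<longleftrightarrow> norm z = 1 \<and> cos (pi / n) < Re (cnj e * z)"
    using cos_signed_angle[OF e _ C] unfolding facing_arc_def open_facing_arc_def P by auto
qed

subsection \<open>The finite Gauss map\<close>

lemma Re_cis_mult:
  assumes "norm z = 1"
  shows "Re (cnj (cis x) * z) = cos (x - Arg z)"
proof -
  have "z = cis (Arg z)" using rcis_cmod_Arg[of z] assms by (simp add: rcis_def)
  then have "Re (cnj (cis x) * z) = Re (cis (- x) * cis (Arg z))" by (simp add: cis_cnj)
  then show ?thesis using cos_minus[of "x - Arg z"] by (simp add: cis_mult)
qed

lemma norm_chord_map:
  assumes "norm z = 1" "0 < C" "C < 1"
  shows "norm (chord_map C z) = 1"
proof -
  have "(1 / of_real C - z) / (1 - cnj (1 / of_real C) * z) = chord_map C z"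
    using chord_map_rotate[of 1 C z] assms by simp
  moreover have "norm (1 / of_real C :: complex) > 1" using assms by (simp add: norm_divide)
  ultimately have "chord_map C z \<in> sphere 0 1"
    using line_inter_unit_circle[of z "1 / of_real C"] assms by (metis Int_iff insertCI)
  then show ?thesis by simp
qed

lemma unit_eq_cis:
  assumes "norm y = 1" "Re y = cos a"
  shows "y = cis a \<or> y = cis (- a)"
proof -
  have "(Im y)\<^sup>2 = (sin a)\<^sup>2"
    using assms cmod_power2[of y] by (simp add: sin_squared_eq)
  then show ?thesis using assms(2) by (auto simp: power2_eq_iff complex_eq_iff)
qed

section \<open>The polygon in normal form: branches of the map and transport of the density\<close>

locale gauss_polygon =
  fixes n :: nat and P :: "int \<Rightarrow> complex" and \<alpha> :: real
  assumes n: "n \<ge> 3"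
    and vertices: "range P = (\<lambda>k. cis (\<alpha> + 2 * pi / n * real k) / of_real (cos (pi / n))) ` {..<n}"
begin

definition C :: real where "C = cos (pi / n)"
definition S :: real where "S = sin (pi / n)"
definition e :: "nat \<Rightarrow> complex" where "e k = cis (\<alpha> + 2 * pi / n * real k)"
text \<open>On the unit circle this is the cosine of the angle seen from the \<open>k\<close>-th
  vertex, so \<open>C \<le> D k z\<close> describes the facing arc.\<close>

definition D :: "nat \<Rightarrow> complex \<Rightarrow> real" where "D k = (\<lambda>z. Re (cnj (e k) * z))"
text \<open>The chord involution through the vertex \<open>e k / C\<close>, taken on the whole
  circle and not just on the facing arc.\<close>

definition T :: "nat \<Rightarrow> complex \<Rightarrow> complex" where "T k = (\<lambda>z. e k * chord_map C (cnj (e k) * z))"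

lemma angle: "0 < pi / n" "pi / n < pi / 2" "pi / n < pi"
  using n by (auto simp: field_simps)

lemma C_bounds: "0 < C" "C < 1"
proof -
  show "0 < C" unfolding C_def using angle by (intro cos_gt_zero) auto
  have "cos (pi / n) < cos 0" using angle by (intro cos_monotone_0_pi) auto
  then show "C < 1" by (simp add: C_def)
qed

lemma S_pos: "0 < S"
  unfolding S_def using angle by (intro sin_gt_zero) auto

lemma norm_e [simp]: "norm (e k) = 1"
  by (simp add: e_def)

lemma vertex_obtain:
  obtains k where "k < n" "P j = e k / of_real C"
proof -
  have "P j \<in> range P" by simp
  then show ?thesis using that unfolding vertices e_def C_def by blast
qed

lemma vertex_index_obtain:
  assumes "k < n"
  obtains j where "P j = e k / of_real C"
proof -
  have "e k / of_real C \<in> range P" unfolding vertices e_def C_def using assms by blast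
  then show ?thesis using that by (metis rangeE)
qed

lemma D_eq: "norm z = 1 \<Longrightarrow> D k z = cos (\<alpha> - Arg z + 2 * pi / n * real k)"
  unfolding D_def e_def by (subst Re_cis_mult) (auto simp: algebra_simps)

lemma D_cover: "norm z = 1 \<Longrightarrow> \<exists>k<n. C \<le> D k z"
  using arcs_cover[of n "\<alpha> - Arg z"] n by (simp add: D_eq C_def)

lemma D_overlap: "norm z = 1 \<Longrightarrow> k < n \<Longrightarrow> l < n \<Longrightarrow> C < D k z \<Longrightarrow> C \<le> D l z \<Longrightarrow> k = l"
  using arcs_overlap[of k n l "\<alpha> - Arg z"] by (simp add: D_eq C_def)

lemma T_endpoint:
  assumes "norm z = 1" "D k z = C"
  shows "T k z = z"
proof -
  have "chord_map C (cnj (e k) * z) = cnj (e k) * z"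
    using assms C_bounds by (intro chord_map_fixed) (auto simp: norm_mult D_def)
  moreover have "e k * cnj (e k) = 1" by (simp add: complex_norm_square[symmetric])
  ultimately show ?thesis by (simp add: T_def flip: mult.assoc)
qed

lemma norm_T: "norm z = 1 \<Longrightarrow> norm (T k z) = 1"
  unfolding T_def using C_bounds by (simp add: norm_mult norm_chord_map)

lemma line_inter_T:
  assumes "norm z = 1"
  shows "affine hull {e k / of_real C, z} \<inter> sphere 0 1 = {z, T k z}"
proof -
  have "norm (e k / of_real C) > 1" using C_bounds by (simp add: norm_divide)
  then show ?thesis
    using line_inter_unit_circle[OF assms] chord_map_rotate[of "e k" C z] C_bounds
    by (simp add: T_def)
qed

text \<open>The description is well defined because two different arcs share only endpoints, and
  each of their branches fixes such a point.\<close>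

lemma finite_gauss_map_eq:
  assumes z: "norm z = 1" and k: "k < n" "C \<le> D k z"
  shows "finite_gauss_map n P z = T k z"
proof -
  have agree: "T l z = T k z" if l: "l < n" "C \<le> D l z" for l
    using D_overlap[OF z k(1) l(1)] D_overlap[OF z l(1) k(1)] T_endpoint[OF z] k l
    by (metis order_le_less)
  show ?thesis
    unfolding finite_gauss_map_def
  proof (rule the_equality)
    obtain j where j: "P j = e k / of_real C" using vertex_index_obtain[OF k(1)] .
    then show "\<exists>j. z \<in> facing_arc n P j \<and> affine hull {P j, z} \<inter> sphere 0 1 = {z, T k z}"
      using facing_arc_iff(1)[of P j "e k" n z] line_inter_T[OF z, of k] z k n
      by (intro exI[of _ j]) (auto simp: C_def D_def)
  next
    fix w assume "\<exists>j. z \<in> facing_arc n P j \<and> affine hull {P j, z} \<inter> sphere 0 1 = {z, w}"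
    then obtain j where j: "z \<in> facing_arc n P j" "affine hull {P j, z} \<inter> sphere 0 1 = {z, w}"
      by blast
    obtain l where l: "l < n" "P j = e l / of_real C" by (rule vertex_obtain)
    have "{z, w} = {z, T l z}" using j(2) line_inter_T[OF z, of l] l by simp
    then have "w = T l z" by (auto simp: doubleton_eq_iff)
    moreover have "C \<le> D l z"
      using facing_arc_iff(1)[of P j "e l" n z] j(1) l n by (auto simp: C_def D_def)
    ultimately show "w = T k z" using agree l(1) by simp
  qed
qed

lemma measurable_T: "T k \<in> circle_borel \<rightarrow>\<^sub>M circle_borel"
proof -
  have "T k \<in> borel_measurable borel" unfolding T_def by measurable
  then show ?thesis
    unfolding circle_borel_def
    by (intro measurable_restrict_space2 measurable_restrict_space1)
      (auto simp: space_restrict_space norm_T)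
qed

lemma measurable_D [measurable]: "D k \<in> borel_measurable borel"
  unfolding D_def by measurable

text \<open>The finitely many closed arcs cover the circle, and on each of them the map is a Borel
  branch.\<close>

lemma measurable_finite_gauss_map: "finite_gauss_map n P \<in> circle_borel \<rightarrow>\<^sub>M circle_borel"
proof (rule measurable_piecewise_restrict[where C = "(\<lambda>k. {z. C \<le> D k z}) ` {..<n}"])
  show "countable ((\<lambda>k. {z. C \<le> D k z}) ` {..<n})"
    by (intro countable_finite finite_imageI finite_lessThan)
  show "\<Omega> \<inter> space circle_borel \<in> sets circle_borel" if "\<Omega> \<in> (\<lambda>k. {z. C \<le> D k z}) ` {..<n}" for \<Omega>
    using that by (auto simp: sets_circle_borel)
  show "space circle_borel \<subseteq> \<Union> ((\<lambda>k. {z. C \<le> D k z}) ` {..<n})"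
  proof
    fix z assume "z \<in> space circle_borel"
    then obtain k where "k < n" "C \<le> D k z" using D_cover[of z] by auto
    then show "z \<in> \<Union> ((\<lambda>k. {z. C \<le> D k z}) ` {..<n})" by auto
  qed
  fix \<Omega> assume "\<Omega> \<in> (\<lambda>k. {z. C \<le> D k z}) ` {..<n}"
  then obtain k where k: "k < n" "\<Omega> = {z. C \<le> D k z}" by blast
  have "finite_gauss_map n P \<in> restrict_space circle_borel \<Omega> \<rightarrow>\<^sub>M circle_borel
      \<longleftrightarrow> T k \<in> restrict_space circle_borel \<Omega> \<rightarrow>\<^sub>M circle_borel"
    by (rule measurable_cong) (simp add: space_restrict_space k finite_gauss_map_eq)
  then show "finite_gauss_map n P \<in> restrict_space circle_borel \<Omega> \<rightarrow>\<^sub>M circle_borel"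
    using measurable_restrict_space1[OF measurable_T] by blast
qed

text \<open>Each equation \<open>D k z = C\<close> has at most two solutions on the circle. Away
  from this finite set exactly one open arc contains \<open>z\<close>, and the density is prescribed
  there.\<close>

lemma AE_not_endpoint: "AE z in arc_length_measure. norm z = 1 \<and> (\<forall>k<n. D k z \<noteq> C)"
proof -
  have "AE z in arc_length_measure. \<forall>k\<in>{..<n}. z \<noteq> e k * cis (pi / n) \<and> z \<noteq> e k * cis (- (pi / n))"
    using AE_arc_length_neq by (intro AE_finite_allI) auto
  moreover have "AE z in arc_length_measure. norm z = 1"
    by (rule AE_I2) simp
  ultimately show ?thesis
  proof eventually_elim
    case (elim z)
    have "D k z \<noteq> C" if k: "k < n" for k
    proof
      assume "D k z = C"
      then have "cnj (e k) * z = cis (pi / n) \<or> cnj (e k) * z = cis (- (pi / n))"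
        using elim by (intro unit_eq_cis) (auto simp: norm_mult D_def C_def)
      moreover have "e k * (cnj (e k) * z) = z"
        by (simp add: complex_norm_square[symmetric] flip: mult.assoc)
      ultimately show False using elim k by (metis lessThan_iff)
    qed
    then show ?case using elim by simp
  qed
qed

lemma unique_arc:
  assumes z: "norm z = 1" "\<forall>k<n. D k z \<noteq> C"
  obtains k where "k < n" "C < D k z" "\<And>l. l < n \<Longrightarrow> l \<noteq> k \<Longrightarrow> D l z < C"
proof -
  obtain k where k: "k < n" "C < D k z" using D_cover[OF z(1)] z(2) by (metis order_le_less)
  have "D l z < C" if "l < n" "l \<noteq> k" for l
    using D_overlap[OF z(1) k(1) that(1) k(2)] that by force
  then show ?thesis using that k by blast
qed

text \<open>In the vanishing sum only the term of the arc containing \<open>z\<close> is negative;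
  moving it across shows that what the other branches bring to \<open>z\<close> equals the density
  there. The remaining terms are nonnegative, so the real identity passes to
  \<open>ennreal\<close>.\<close>

lemma density_balance:
  assumes z: "norm z = 1" "\<forall>k<n. D k z \<noteq> C" and k: "k < n" "C < D k z"
    and l: "\<And>l. l < n \<Longrightarrow> l \<noteq> k \<Longrightarrow> D l z < C"
  shows "(\<Sum>l<n. ennreal (S / (C - D l z)) * indicator {y. Re y < C} (cnj (e l) * z))
    = ennreal (S / (D k z - C))"
proof -
  have "(\<Sum>l<n. S / (C - D l z)) = 0"
    using sum_inverse_cos_diff_eq_0[of n "\<alpha> - Arg z"] z n by (simp add: D_eq S_def C_def)
  then have "S / (C - D k z) + (\<Sum>l\<in>{..<n}-{k}. S / (C - D l z)) = 0"
    using k by (subst (asm) sum.remove[of _ k]) auto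
  moreover have "S / (C - D k z) = - (S / (D k z - C))"
    by (metis minus_diff_eq minus_divide_right)
  ultimately have bal: "(\<Sum>l\<in>{..<n}-{k}. S / (C - D l z)) = S / (D k z - C)" by simp
  have "(\<Sum>l<n. ennreal (S / (C - D l z)) * indicator {y. Re y < C} (cnj (e l) * z))
      = (\<Sum>l\<in>{..<n}-{k}. ennreal (S / (C - D l z)) * indicator {y. Re y < C} (cnj (e l) * z))"
    using k by (subst sum.remove[of _ k]) (auto simp: D_def)
  also have "\<dots> = (\<Sum>l\<in>{..<n}-{k}. ennreal (S / (C - D l z)))"
    using l by (intro sum.cong) (auto simp: D_def)
  also have "\<dots> = ennreal (\<Sum>l\<in>{..<n}-{k}. S / (C - D l z))"
    using l S_pos by (intro sum_ennreal) (auto intro!: divide_nonneg_nonneg less_imp_le)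
  finally show ?thesis unfolding bal .
qed

lemma nn_integral_branch:
  assumes [measurable]: "A \<in> sets borel"
  shows "(\<integral>\<^sup>+z. ennreal (S / (D k z - C)) * indicator {y. C < Re y} (cnj (e k) * z) * indicator A (T k z)
            \<partial>arc_length_measure)
    = (\<integral>\<^sup>+z. ennreal (S / (C - D k z)) * indicator {y. Re y < C} (cnj (e k) * z) * indicator A z
            \<partial>arc_length_measure)"
proof -
  \<comment> \<open>The rotation back to vertex \<open>k\<close> is put into the test function, so
    that \<open>H (chord_map C (cnj (e k) * z))\<close> is
    \<open>indicator A (T k z)\<close>.\<close>
  define H :: "complex \<Rightarrow> ennreal" where "H y = indicator A (e k * y)" for y
  have H [measurable]: "H \<in> borel_measurable borel"
    unfolding H_def by (rule measurable_compose[OF _ borel_measurable_indicator[OF assms]]) measurable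
  let ?F = "\<lambda>y. ennreal (S / (Re y - C)) * indicator {y. C < Re y} y * H (chord_map C y)"
  let ?G = "\<lambda>y. ennreal (S / (C - Re y)) * indicator {y. Re y < C} y * H y"
  have F: "?F \<in> borel_measurable borel" by measurable
  have G: "?G \<in> borel_measurable borel" by measurable
  have rotate: "e k * (cnj (e k) * z) = z" for z
    by (simp add: complex_norm_square[symmetric] flip: mult.assoc)
  have "(\<integral>\<^sup>+z. ?F (cnj (e k) * z) \<partial>arc_length_measure) = (\<integral>\<^sup>+z. ?F z \<partial>arc_length_measure)"
    by (rule nn_integral_rotate[of ?F "cnj (e k)"]) (rule F, simp)
  also have "\<dots> = (\<integral>\<^sup>+z. ?G z \<partial>arc_length_measure)"
    unfolding C_def S_def using angle H by (intro nn_integral_chord_map) auto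
  also have "\<dots> = (\<integral>\<^sup>+z. ?G (cnj (e k) * z) \<partial>arc_length_measure)"
    by (rule nn_integral_rotate[of ?G "cnj (e k)", symmetric]) (rule G, simp)
  finally show ?thesis by (simp only: H_def rotate T_def D_def)
qed

lemma density_on_arc:
  assumes f: "\<And>j z. z \<in> open_facing_arc n P j \<Longrightarrow>
      f z = ennreal (sin (pi / real n) / (cos (signed_angle (P j) z) - cos (pi / real n)))"
    and z: "norm z = 1" and k: "k < n" "C < D k z"
  shows "f z = ennreal (S / (D k z - C))"
proof -
  obtain j where j: "P j = e k / of_real C" using vertex_index_obtain[OF k(1)] .
  have "z \<in> open_facing_arc n P j"
    using facing_arc_iff(2)[of P j "e k" n z] j z k n by (auto simp: C_def D_def)
  then show ?thesis
    using f cos_signed_angle[OF norm_e z C_bounds(1), of k] by (simp add: j S_def C_def D_def)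
qed

end

section \<open>Invariance of the measure\<close>

theorem corollary1:
  fixes n :: nat and P :: "int \<Rightarrow> complex"
    and f :: "complex \<Rightarrow> ennreal" and \<mu> :: "complex measure"
  assumes "n \<ge> 3"
    and "regular_polygon n P"
    and "circumscribed P"
    and "f \<in> borel_measurable circle_borel"
    and "\<And>j z. z \<in> open_facing_arc n P j \<Longrightarrow>
           f z = ennreal (sin (pi / real n) / (cos (signed_angle (P j) z) - cos (pi / real n)))"
    and "\<mu> = density arc_length_measure f"
  shows "sigma_finite_measure \<mu> \<and>
    finite_gauss_map n P \<in> circle_borel \<rightarrow>\<^sub>M circle_borel \<and>
    (\<forall>A \<in> sets borel. A \<subseteq> sphere 0 1 \<longrightarrow>
      emeasure \<mu> (finite_gauss_map n P -` A \<inter> sphere 0 1) = emeasure \<mu> A)"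
proof -
  obtain \<alpha> where "range P = (\<lambda>k. cis (\<alpha> + 2 * pi / n * real k) / of_real (cos (pi / n))) ` {..<n}"
    using circumscribed_regular_polygon_vertices[OF assms(2,3)] .
  then interpret gauss_polygon n P \<alpha> using assms(1) by unfold_locales
  interpret L: finite_measure arc_length_measure by (rule finite_measure_arc_length)
  note f_arc = density_on_arc[where f = f, OF assms(5)]
  let ?G = "finite_gauss_map n P"
  have f: "f \<in> borel_measurable arc_length_measure"
    using assms(4) by (simp cong: measurable_cong_sets)
  \<comment> \<open>The density blows up only towards the arc endpoints, a null set; finiteness
    almost everywhere gives sigma-finiteness even if the total mass is infinite.\<close>
  have "AE z in arc_length_measure. f z \<noteq> \<infinity>"
    using AE_not_endpoint
  proof eventually_elim
    case (elim z)
    then obtain k where "k < n" "C < D k z" using unique_arc[of z] by metis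
    then show ?case using f_arc elim by simp
  qed
  then have "sigma_finite_measure \<mu>"
    unfolding assms(6) using L.sigma_finite_iff_density_finite[OF f] by simp
  moreover have "emeasure \<mu> (?G -` A \<inter> sphere 0 1) = emeasure \<mu> A"
    if A [measurable]: "A \<in> sets borel" "A \<subseteq> sphere 0 1" for A
  proof -
    have A_circle: "A \<in> sets circle_borel" using A by (simp add: sets_circle_borel)
    \<comment> \<open>\<open>?out k\<close> records the mass that leaves arc \<open>k\<close> and
      lands in \<open>A\<close>, seen at its source; \<open>?in k\<close> is the same mass seen at
      its destination.\<close>
    let ?out = "\<lambda>k z. ennreal (S / (D k z - C)) * indicator {y. C < Re y} (cnj (e k) * z) * indicator A (T k z)"
    let ?in = "\<lambda>k z. ennreal (S / (C - D k z)) * indicator {y. Re y < C} (cnj (e k) * z) * indicator A z"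
    have [measurable]: "T k \<in> borel_measurable borel" for k unfolding T_def by measurable
    have out: "(\<lambda>z. ?out k z) \<in> borel_measurable arc_length_measure" for k
      unfolding measurable_cong_sets[OF sets_arc_length_measure refl]
      by (rule borel_measurable_circle) measurable
    have "in": "(\<lambda>z. ?in k z) \<in> borel_measurable arc_length_measure" for k
      unfolding measurable_cong_sets[OF sets_arc_length_measure refl]
      by (rule borel_measurable_circle) measurable
    have "emeasure \<mu> (?G -` A \<inter> sphere 0 1)
        = (\<integral>\<^sup>+z. f z * indicator (?G -` A \<inter> sphere 0 1) z \<partial>arc_length_measure)"
      unfolding assms(6)
      using measurable_sets[OF measurable_finite_gauss_map A_circle]
      by (intro emeasure_density f) simp
    \<comment> \<open>Off the endpoints just one arc contains \<open>z\<close>, so a single summand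
      survives, and there the map is \<open>T k\<close>.\<close>
    also have "\<dots> = (\<integral>\<^sup>+z. (\<Sum>k<n. ?out k z) \<partial>arc_length_measure)"
    proof (rule nn_integral_cong_AE)
      show "AE z in arc_length_measure. f z * indicator (?G -` A \<inter> sphere 0 1) z = (\<Sum>k<n. ?out k z)"
        using AE_not_endpoint
      proof eventually_elim
        case (elim z)
        then obtain k where k: "k < n" "C < D k z" "\<And>l. l < n \<Longrightarrow> l \<noteq> k \<Longrightarrow> D l z < C"
          using unique_arc[of z] by metis
        have "?G z = T k z" using finite_gauss_map_eq elim k by simp
        then have "f z * indicator (?G -` A \<inter> sphere 0 1) z = ?out k z"
          using f_arc[of z k] elim k(1,2) by (auto simp: D_def split: split_indicator)
        also have "\<dots> = (\<Sum>k<n. ?out k z)"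
        proof -
          have "(\<Sum>l\<in>{..<n}-{k}. ?out l z) = 0"
            using k(3) by (intro sum.neutral) (force simp: D_def split: split_indicator)
          then show ?thesis using k(1) by (subst sum.remove[of _ k]) auto
        qed
        finally show ?case .
      qed
    qed
    also have "\<dots> = (\<Sum>k<n. \<integral>\<^sup>+z. ?out k z \<partial>arc_length_measure)"
      by (rule nn_integral_sum) (rule out)
    also have "\<dots> = (\<Sum>k<n. \<integral>\<^sup>+z. ?in k z \<partial>arc_length_measure)"
      by (simp only: nn_integral_branch[OF A(1)])
    also have "\<dots> = (\<integral>\<^sup>+z. (\<Sum>k<n. ?in k z) \<partial>arc_length_measure)"
      by (rule nn_integral_sum[symmetric]) (rule "in")
    \<comment> \<open>At a fixed destination the contributions of all branches add up to the
      density, by the balance.\<close>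
    also have "\<dots> = (\<integral>\<^sup>+z. f z * indicator A z \<partial>arc_length_measure)"
    proof (rule nn_integral_cong_AE)
      show "AE z in arc_length_measure. (\<Sum>k<n. ?in k z) = f z * indicator A z"
        using AE_not_endpoint
      proof eventually_elim
        case (elim z)
        then obtain k where k: "k < n" "C < D k z" "\<And>l. l < n \<Longrightarrow> l \<noteq> k \<Longrightarrow> D l z < C"
          using unique_arc[of z] by metis
        then show ?case
          using density_balance[of z k] f_arc[of z k] elim by (simp flip: sum_distrib_right)
      qed
    qed
    also have "\<dots> = emeasure \<mu> A"
      unfolding assms(6) using A_circle by (intro emeasure_density[symmetric] f) simp
    finally show ?thesis .
  qed
  ultimately show ?thesis using measurable_finite_gauss_map by blast
qed

end
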